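(* Let $d\ge 1$ and let $\mathbb{P}$ be the probability distribution on $\mathcal{P}([0,1]^d)$ described in the context. Then for every sequence $\delta_k$ of positive reals decreasing to $0$ (used to compute the limit $\delta\to 0$), $$\mathbb{P}\left\{\mu:\ \lim_{\delta\to 0}\ \limsup_{m\to\infty}\frac{\log_2 H_{m,\delta}(\mu)}{m}<\infty\right\}=0,$$ where the event means that the limit along the sequence exists and is finite. In particular, the upper quasi-Assouad dimension satisfies $\dim_{qA}\mu=\infty$ for $\mathbb{P}$-a.e. $\mu$.
   Context: $\mathcal{P}([0,1]^d)$ is the space of Borel probability measures on $[0,1]^d$, with the weak$^*$ topology. Dyadic cubes and labels. Put $n=2^d$, $\Lambda=\{1,\dots,n\}$, $\Omega=\bigcup_{k\ge 0}\Lambda^k$ (finite words, including the empty word $\emptyset$; $|\omega|$ is the length of $\omega$). Words index the nodes of the complete $n$-ary tree and the dyadic subcubes $Q_\omega$ of $[0,1]^d$: $Q_\emptyset=[0,1]^d$, and $Q_{\omega 1},\dots,Q_{\omega n}$ are the $2^d$ dyadic cubes of side length $2^{-|\omega|-1}$ partitioning $Q_\omega$ (products of half-open intervals $[a,b)$, closed on the right when $b=1$). A measure $\mu$ corresponds to the labeled tree $T$ with node labels $m_T(\omega)=\mu(Q_\omega)$; the edge from $\omega$ to $\omega i$ is labeled by the ratio $m_T(\omega i)/m_T(\omega)$, so each node label is the product of the edge labels on the path from the root. Distribution $\mathbb{P}$. Let $X^\omega=(X^\omega_1,\dots,X^\omega_n)$, $\omega\in\Omega$, be independent random vectors, each uniformly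 distributed on the simplex $\{(x_1,\dots,x_n): x_i\ge 0,\ \sum_i x_i=1\}$. Use $X^\omega_i$ as the label of the edge from $\omega$ to $\omega i$. Almost surely this determines a unique random measure $\mu\in\mathcal{P}([0,1]^d)$ with $\mu(Q_{\omega_1\cdots\omega_k})=\prod_{j=1}^k X^{\omega_1\cdots\omega_{j-1}}_{\omega_j}$ for all words. $\mathbb{P}$ is the law of $\mu$. Central children and $H_{m,\delta}$. For $m\in\mathbb{N}$, $m\ge1$, and a word $\omega$, a central child of $\omega$ is a word $\omega'$ of length $|\omega|+m$ extending $\omega$ such that the closure of $Q_{\omega'}$ contains the center of $Q_\omega$ (there are $2^d$ of these). For $\delta>0$, $$H_{m,\delta}(\mu)=\max_{|\omega|=\lfloor m/\delta\rfloor}\ \min_{\omega'\text{ a central child of }\omega}\frac{m_T(\omega)}{m_T(\omega')},$$ where $m_T(\omega)/m_T(\omega')$ is the reciprocal of the product of the $m$ edge labels on the path from $\omega$ to $\omega'$ ($+\infty$ if this product is $0$). Upper quasi-Assouad dimension. For $\mu\in\mathcal{P}([0,1]^d)$ and $\delta>0$, let $H(\mu,\delta)$ be the infimum (with $\inf\emptyset=\infty$) of all $s$ for which there is $C>0$ such that for all $0<r<R^{1+\delta}<R<1$, $\sup_{x\in\operatorname{supp}\mu}\frac{\mu(B(x,R))}{\mu(B(x,r))}\le C\left(\frac Rr\right)^s$. Then $\dim_{qA}\mu=\lim_{\delta\to0}H(\mu,\delta)$ (the limit exists in $[0,\infty]$ by monotonicity). Balls are Euclidean (any equivalent metric, e.g.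 the supremum metric, gives the same value). *)

theory Defs
  imports "HOL-Probability.Probability" "HOL-Library.Sublist"
begin

subsection \<open>Measures on the unit cube\<close>

definition unit_cube :: "(real ^ 'd) set" where
  "unit_cube = {x. \<forall>j. 0 \<le> x $ j \<and> x $ j \<le> 1}"

text \<open>The space of Borel probability measures on the unit cube. Its sigma-algebra is generated by
  the evaluation maps at Borel sets; as the cube is compact and metrizable, this is the Borel
  sigma-algebra of the weak* topology. The elements are measures whose underlying space is
  \<^const>\<open>unit_cube\<close>, so subsets of the ambient space have to be intersected with it before they
  are measured.\<close>

definition cube_prob :: "(real ^ 'd) measure measure" where
  "cube_prob = prob_algebra (restrict_space borel unit_cube)"

definition supp :: "(real ^ 'd) measure \<Rightarrow> (real ^ 'd) set" where
  "supp \<mu> = {x \<in> space \<mu>. \<forall>U. open U \<and> x \<in> U \<longrightarrow> measure \<mu> (U \<inter> space \<mu>) > 0}"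

subsection \<open>Words and dyadic cubes\<close>

definition letters :: "nat \<Rightarrow> nat set" where
  "letters n = {1..n}"

abbreviation words :: "nat \<Rightarrow> nat list set" where
  "words n \<equiv> lists (letters n)"

text \<open>The correspondence between letters and subcubes is given by a map \<open>c\<close> from letters to sets of
  coordinates: passing to child \<open>i\<close> selects the upper half of the cube in the coordinates
  belonging to \<open>c i\<close> and the lower half in the others. For \<open>n = 2 ^ d\<close>, an enumeration
  of the subcubes is a bijection from \<open>letters n\<close> onto all sets of coordinates.\<close>

definition low :: "(nat \<Rightarrow> 'd set) \<Rightarrow> nat list \<Rightarrow> 'd \<Rightarrow> real" where
  "low c \<omega> j = (\<Sum>t<length \<omega>. (if j \<in> c (\<omega> ! t) then 1 else 0) / 2 ^ Suc t)"

definition side :: "nat list \<Rightarrow> real" where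
  "side \<omega> = 1 / 2 ^ length \<omega>"

definition dyadic_cube :: "(nat \<Rightarrow> 'd set) \<Rightarrow> nat list \<Rightarrow> (real ^ 'd) set" where
  "dyadic_cube c \<omega> =
     {x. \<forall>j. x $ j \<in> (if low c \<omega> j + side \<omega> = 1 then {low c \<omega> j..1}
                      else {low c \<omega> j..<low c \<omega> j + side \<omega>})}"

definition center :: "(nat \<Rightarrow> 'd set) \<Rightarrow> nat list \<Rightarrow> real ^ 'd" where
  "center c \<omega> = (\<chi> j. low c \<omega> j + side \<omega> / 2)"

definition central_children ::
    "nat \<Rightarrow> (nat \<Rightarrow> ('d::finite) set) \<Rightarrow> nat \<Rightarrow> nat list \<Rightarrow> nat list set" where
  "central_children n c m \<omega> =
     {\<omega>' \<in> words n. prefix \<omega> \<omega>' \<and> length \<omega>' = length \<omega> + m \<and>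
        center c \<omega> \<in> closure (dyadic_cube c \<omega>')}"

subsection \<open>The random measure\<close>

text \<open>The uniform distribution on the simplex of nonnegative vectors indexed by \<open>{1..n}\<close> with
  coordinate sum 1: this simplex is the graph of an affine function over a full-dimensional simplex
  in the first \<open>n - 1\<close> coordinates, so its normalized \<open>(n - 1)\<close>-dimensional volume is the image of
  normalized Lebesgue measure there.\<close>

definition simplex_uniform :: "nat \<Rightarrow> (nat \<Rightarrow> real) measure" where
  "simplex_uniform n =
     distr (uniform_measure (PiM {1..<n} (\<lambda>_. lborel))
              {y \<in> space (PiM {1..<n} (\<lambda>_. lborel)).
                 (\<forall>i\<in>{1..<n}. 0 \<le> y i) \<and> (\<Sum>i\<in>{1..<n}. y i) \<le> 1})
       (PiM (letters n) (\<lambda>_. borel))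
       (\<lambda>y. \<lambda>i\<in>letters n. if i < n then y i else 1 - (\<Sum>k\<in>{1..<n}. y k))"

text \<open>\<open>X \<omega>\<close> is the vector of labels of the edges leading from \<open>\<omega>\<close> to its children, and \<open>\<mu>\<close> is a
  random measure which almost surely has the products of edge labels as masses of the dyadic
  cubes.\<close>

definition random_cascade ::
    "nat \<Rightarrow> (nat \<Rightarrow> ('d::finite) set) \<Rightarrow> 'a measure \<Rightarrow> (nat list \<Rightarrow> 'a \<Rightarrow> nat \<Rightarrow> real) \<Rightarrow>
      ('a \<Rightarrow> (real ^ 'd) measure) \<Rightarrow> bool" where
  "random_cascade n c M X \<mu> \<longleftrightarrow>
     prob_space M \<and>
     prob_space.indep_vars M (\<lambda>_. PiM (letters n) (\<lambda>_. borel)) X (words n) \<and>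
     (\<forall>\<omega>\<in>words n. distr M (PiM (letters n) (\<lambda>_. borel)) (X \<omega>) = simplex_uniform n) \<and>
     \<mu> \<in> measurable M cube_prob \<and>
     (AE x in M. \<forall>\<omega>\<in>words n.
        measure (\<mu> x) (dyadic_cube c \<omega>) = (\<Prod>j<length \<omega>. X (take j \<omega>) x (\<omega> ! j)))"

subsection \<open>The quantity H and the quasi-Assouad dimension\<close>

text \<open>Ratio of the masses of a cube and a descendant of it, i.e. the reciprocal of the product of the
  edge labels in between. It is infinite if the descendant has mass 0 (also in the case \<open>0 / 0\<close>,
  where the edge labels are not determined by the measure).\<close>

definition mass_ratio ::
    "(nat \<Rightarrow> 'd set) \<Rightarrow> (real ^ ('d::finite)) measure \<Rightarrow> nat list \<Rightarrow> nat list \<Rightarrow> ereal" where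
  "mass_ratio c \<mu> \<omega> \<omega>' =
     (if measure \<mu> (dyadic_cube c \<omega>') = 0 then \<infinity>
      else ereal (measure \<mu> (dyadic_cube c \<omega>) / measure \<mu> (dyadic_cube c \<omega>')))"

definition H_max ::
    "nat \<Rightarrow> (nat \<Rightarrow> 'd set) \<Rightarrow> nat \<Rightarrow> real \<Rightarrow> (real ^ ('d::finite)) measure \<Rightarrow> ereal" where
  "H_max n c m \<delta> \<mu> =
     (MAX \<omega>\<in>{\<omega> \<in> words n. length \<omega> = nat \<lfloor>real m / \<delta>\<rfloor>}.
        MIN \<omega>'\<in>central_children n c m \<omega>. mass_ratio c \<mu> \<omega> \<omega>')"

text \<open>Binary logarithm on \<open>(0, \<infinity>]\<close>; the values of \<^const>\<open>H_max\<close> are at least 1.\<close>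

definition elog2 :: "ereal \<Rightarrow> ereal" where
  "elog2 x = (if x = \<infinity> then \<infinity> else ereal (log 2 (real_of_ereal x)))"

definition qA_exponent :: "(real ^ ('d::finite)) measure \<Rightarrow> real \<Rightarrow> ereal" where
  "qA_exponent \<mu> \<delta> =
     Inf {ereal s | s. \<exists>C>0. \<forall>r R. 0 < r \<and> r < R powr (1 + \<delta>) \<and> R powr (1 + \<delta>) < R \<and> R < 1 \<longrightarrow>
            (SUP x\<in>supp \<mu>. ereal (measure \<mu> (ball x R \<inter> space \<mu>) / measure \<mu> (ball x r \<inter> space \<mu>)))
              \<le> ereal (C * (R / r) powr s)}"

definition dim_qA :: "(real ^ ('d::finite)) measure \<Rightarrow> ereal" where
  "dim_qA \<mu> = Lim (at_right 0) (qA_exponent \<mu>)"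

end

theory Submission
  imports Defs
begin

text \<open>The central children of a cube are reached by stepping to one of the corners and then always
  towards the opposite corner. Asking all labels along these \<open>n\<close> paths of length \<open>m\<close> to be at most
  \<open>\<epsilon>\<close> has probability at least \<open>q ^ (n * m)\<close>, where \<open>q > 0\<close> depends on \<open>\<epsilon>\<close> but not on \<open>\<delta>\<close>, whereas
  there are about \<open>n powr (m / \<delta>)\<close> cubes on the level considered, with independent events. For small
  \<open>\<delta>\<close> some cube of that level has this property for all large \<open>m\<close>, by Borel and Cantelli, so that \<open>H\<close>
  is at least about \<open>\<epsilon> ^ - m\<close>. Balls around the center of such a cube also show that the
  quasi-Assouad dimension is large; the center belongs to the support since all labels are almost
  surely positive.\<close>

subsection \<open>Dyadic cubes and central children\<close>

lemma side_append: "side (u @ v) = side u * side v"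
  by (simp add: side_def power_add)

lemma low_Nil [simp]: "low c [] j = 0"
  by (simp add: low_def)

text \<open>\<open>low c u j\<close> is a binary expansion whose digits record which letters of
  \<open>u\<close> select the upper half in coordinate \<open>j\<close>; a new leading digit shifts
  the others one place.\<close>

lemma low_Cons: "low c (i # u) j = ((if j \<in> c i then 1 else 0) + low c u j) / 2"
  unfolding low_def length_Cons sum.lessThan_Suc_shift
  by (simp add: sum_divide_distrib add_divide_distrib mult.commute)

lemma low_append: "low c (u @ v) j = low c u j + side u * low c v j"
proof (induction u)
  case (Cons a u)
  then show ?case by (simp add: low_Cons side_def field_simps)
qed (simp add: side_def)

lemma low_nonneg: "0 \<le> low c u j"
  unfolding low_def by (intro sum_nonneg) auto

text \<open>Complementing the letters flips every binary digit, so the two expansions add up to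
  0.11...1 with \<open>length u\<close> digits. Facts about lower ends thereby turn into facts about
  upper ends.\<close>

lemma low_complement: "low c u j + low (\<lambda>i. - c i) u j = 1 - side u"
proof (induction u)
  case (Cons a u)
  have "low c (a # u) j + low (\<lambda>i. - c i) (a # u) j
    = (1 + (low c u j + low (\<lambda>i. - c i) u j)) / 2"
    by (simp add: low_Cons field_simps)
  also have "\<dots> = 1 - side (a # u)"
    by (subst Cons.IH) (simp add: side_def field_simps)
  finally show ?case .
qed (simp add: side_def)

lemma low_side_le_1: "low c u j + side u \<le> 1"
  using low_complement[of c u j] low_nonneg[of "\<lambda>i. - c i" u j] by linarith

lemma low_eq_0_iff: "low c u j = 0 \<longleftrightarrow> (\<forall>i\<in>set u. j \<notin> c i)"
proof (induction u)
  case (Cons a u)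
  then show ?case using low_nonneg[of c u j] by (auto simp: low_Cons)
qed simp

lemma low_replicate: "low c (replicate k i) j = (if j \<in> c i then 1 - 1 / 2 ^ k else 0)"
  by (induction k) (auto simp: low_Cons field_simps)

section \<open>Dyadic cubes as boxes and as Borel subsets of the unit cube\<close>

lemma dyadic_cube_subset_box:
  assumes "x \<in> dyadic_cube c u"
  shows "low c u j \<le> x $ j" "x $ j \<le> low c u j + side u"
proof -
  have "x $ j \<in> (if low c u j + side u = 1 then {low c u j..1}
                      else {low c u j..<low c u j + side u})"
    using assms by (auto simp: dyadic_cube_def)
  then show "low c u j \<le> x $ j" "x $ j \<le> low c u j + side u"
    by (auto split: if_splits)
qed

text \<open>The strict upper bound meets both cases of the definition, so the faces closed at 1 need
  no separate treatment.\<close>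

lemma dyadic_cube_superset_box:
  assumes "\<And>j. low c u j \<le> x $ j" "\<And>j. x $ j < low c u j + side u"
  shows "x \<in> dyadic_cube c u"
  unfolding dyadic_cube_def using assms by (auto intro: less_imp_le) (metis less_imp_le)

lemma closure_dyadic_cube_subset_box:
  fixes x :: "real ^ 'd::finite"
  assumes "x \<in> closure (dyadic_cube c u)"
  shows "low c u j \<le> x $ j" "x $ j \<le> low c u j + side u"
proof -
  have "closed {x::real^'d. low c u j \<le> x $ j}" "closed {x::real^'d. x $ j \<le> low c u j + side u}"
    by (auto intro!: closed_Collect_le continuous_intros)
  then have "closed {x::real^'d. low c u j \<le> x $ j \<and> x $ j \<le> low c u j + side u}"
    using closed_Int by (fastforce simp: Collect_conj_eq)
  then have "closure (dyadic_cube c u) \<subseteq> {x. low c u j \<le> x $ j \<and> x $ j \<le> low c u j + side u}"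
    by (intro closure_minimal) (auto simp: dyadic_cube_subset_box)
  then show "low c u j \<le> x $ j" "x $ j \<le> low c u j + side u"
    using assms by auto
qed

lemma dyadic_cube_subset_unit_cube: "dyadic_cube c u \<subseteq> unit_cube"
proof
  fix x assume "x \<in> dyadic_cube c u"
  from dyadic_cube_subset_box[OF this] show "x \<in> unit_cube"
    unfolding unit_cube_def
    using low_nonneg[of c u] low_side_le_1[of c u] by (smt (verit) mem_Collect_eq)
qed

lemma borel_dyadic_cube: "dyadic_cube c u \<in> sets (borel :: (real ^ 'd::finite) measure)"
proof -
  have "dyadic_cube c u = (\<Inter>j\<in>UNIV. (\<lambda>x::real^'d. x $ j) -`
      (if low c u j + side u = 1 then {low c u j..1} else {low c u j..<low c u j + side u}) \<inter> space borel)"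
    unfolding dyadic_cube_def by (rule set_eqI) (simp only: mem_Collect_eq INT_iff vimage_eq Int_iff space_borel UNIV_I simp_thms ball_UNIV)
  also have "\<dots> \<in> sets borel"
    by (intro sets.finite_INT measurable_sets[of _ borel borel] borel_measurable_continuous_onI
        continuous_intros) auto
  finally show ?thesis .
qed

lemma dyadic_cube_sets: "dyadic_cube c u \<in> sets (restrict_space borel (unit_cube :: (real ^ 'd::finite) set))"
  by (metis borel_dyadic_cube dyadic_cube_subset_unit_cube inf.absorb_iff2 sets_restrict_space imageI)

section \<open>Central children as spokes leaving the center of a cube\<close>

locale dyadic_coding =
  fixes n :: nat and c :: "nat \<Rightarrow> ('d::finite) set"
  assumes n_eq: "n = 2 ^ CARD('d)"
    and bij: "bij_betw c (letters n) UNIV"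
begin

lemma n_ge_2: "2 \<le> n"
  using n_eq self_le_power[of 2 "CARD('d)"] by simp

lemma finite_letters [simp]: "finite (letters n)"
  by (simp add: letters_def)

lemma card_letters: "card (letters n) = n"
  by (simp add: letters_def)

definition letter_of :: "'d set \<Rightarrow> nat" where
  "letter_of = inv_into (letters n) c"

lemma letter_of [simp]: "letter_of S \<in> letters n" "c (letter_of S) = S"
  using bij unfolding letter_of_def bij_betw_def
  by (auto simp: f_inv_into_f inv_into_into)

lemma c_eqD: "i \<in> letters n \<Longrightarrow> c i = S \<Longrightarrow> i = letter_of S"
  using bij by (auto simp: letter_of_def bij_betw_def inv_into_f_f)

text \<open>The child of a cube towards a corner, and then always the child towards the opposite corner:
  these are the descendants which keep the center of the cube in their closure.\<close>

definition spoke :: "nat list \<Rightarrow> nat \<Rightarrow> nat \<Rightarrow> nat list" where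
  "spoke \<omega> i k = \<omega> @ i # replicate k (letter_of (- c i))"

lemma length_spoke [simp]: "length (spoke \<omega> i k) = Suc (length \<omega> + k)"
  by (simp add: spoke_def)

lemma spoke_words [simp]: "\<omega> \<in> words n \<Longrightarrow> i \<in> letters n \<Longrightarrow> spoke \<omega> i k \<in> words n"
  by (auto simp: spoke_def in_lists_conv_set)

lemma side_spoke: "side (spoke \<omega> i k) = side \<omega> / 2 ^ Suc k"
  by (simp add: spoke_def side_def power_add)

text \<open>The center is a vertex of every spoke cube: the digits 1 0...0 keep the lower end at the
  center, while 0 1...1 keep the upper end there.\<close>

lemma low_spoke:
  "low c (spoke \<omega> i k) j =
     (if j \<in> c i then center c \<omega> $ j else center c \<omega> $ j - side (spoke \<omega> i k))"
  unfolding side_spoke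
  by (auto simp: spoke_def low_append low_Cons low_replicate center_def field_simps)

lemma central_children_subset_spokes:
  "central_children n c (Suc k) \<omega> \<subseteq> (\<lambda>i. spoke \<omega> i k) ` letters n"
proof
  fix w assume w: "w \<in> central_children n c (Suc k) \<omega>"
  then obtain u where u: "w = \<omega> @ u" and "length u = Suc k"
    by (auto simp: central_children_def prefix_def)
  then obtain i v where v: "w = \<omega> @ i # v" "length v = k"
    by (cases u) auto
  have i: "i \<in> letters n" and vw: "set v \<subseteq> letters n"
    using w v by (auto simp: central_children_def)
  have cl: "center c \<omega> \<in> closure (dyadic_cube c w)"
    using w by (auto simp: central_children_def)
  have side: "side \<omega> > 0" by (simp add: side_def)
  have lw: "low c w j = low c \<omega> j + side \<omega> * (((if j \<in> c i then 1 else 0) + low c v j) / 2)" for j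
    by (simp add: v low_append low_Cons)
  have sw: "side w = side \<omega> * side v / 2"
    by (simp add: v side_append) (simp add: side_def)
  have "x = letter_of (- c i)" if x: "x \<in> set v" for x
  proof (rule c_eqD)
    show "x \<in> letters n" using vw x by auto
    show "c x = - c i"
    proof (rule set_eqI)
      fix j
      show "j \<in> c x \<longleftrightarrow> j \<in> - c i"
      proof (cases "j \<in> c i")
        case True
        \<comment> \<open>After a first step upwards the lower end is already at the center and must
          not move further up, so all later digits in coordinate \<open>j\<close> are 0.\<close>
        have "side \<omega> * low c v j \<le> 0"
          using closure_dyadic_cube_subset_box(1)[OF cl, of j] True
          by (simp add: lw center_def field_simps)
        then have "low c v j = 0"
          using low_nonneg[of c v j] side by (simp add: mult_le_0_iff)
        then show ?thesis using x True by (auto simp: low_eq_0_iff)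
      next
        case False
        \<comment> \<open>After a first step downwards the upper end must stay at the center. Then
          the flipped expansion vanishes, so all later digits are 1.\<close>
        have "side \<omega> * 1 \<le> side \<omega> * (low c v j + side v)"
          using closure_dyadic_cube_subset_box(2)[OF cl, of j] False
          by (simp add: lw sw center_def field_simps)
        then have "low c v j + side v \<ge> 1"
          using side by (subst (asm) mult_le_cancel_left_pos) auto
        then have "low (\<lambda>i. - c i) v j = 0"
          using low_complement[of c v j] low_nonneg[of "\<lambda>i. - c i" v j] by linarith
        then show ?thesis using x False by (auto simp: low_eq_0_iff)
      qed
    qed
  qed
  then have "v = replicate k (letter_of (- c i))"
    using v(2) by (intro replicate_eqI) auto
  then show "w \<in> (\<lambda>i. spoke \<omega> i k) ` letters n"
    using v i by (auto simp: spoke_def)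
qed

text \<open>The center is the lower corner of this cube, and half-open cubes contain their lower
  corner. This yields a central child, and arbitrarily small dyadic cubes around the center.\<close>

lemma center_in_upper_spoke: "center c \<omega> \<in> dyadic_cube c (spoke \<omega> (letter_of UNIV) k)"
proof (rule dyadic_cube_superset_box)
  show "low c (spoke \<omega> (letter_of UNIV) k) j \<le> center c \<omega> $ j" for j
    by (simp add: low_spoke)
  show "center c \<omega> $ j < low c (spoke \<omega> (letter_of UNIV) k) j + side (spoke \<omega> (letter_of UNIV) k)" for j
    by (simp add: low_spoke) (simp add: side_def)
qed

lemma upper_spoke_central:
  "\<omega> \<in> words n \<Longrightarrow> spoke \<omega> (letter_of UNIV) k \<in> central_children n c (Suc k) \<omega>"
  using center_in_upper_spoke[of \<omega> k] closure_subset
  by (auto simp: central_children_def simp del: spoke_words intro: spoke_words) (auto simp: spoke_def)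

lemma finite_words_length: "finite {\<omega> \<in> words n. length \<omega> = l}"
  using finite_lists_length_eq[OF finite_letters, of l] by (simp add: lists_eq_set)

lemma card_words_length: "card {\<omega> \<in> words n. length \<omega> = l} = n ^ l"
  using card_lists_length_eq[OF finite_letters, of l] by (simp add: lists_eq_set card_letters)

lemma finite_central_children: "finite (central_children n c m \<omega>)"
  by (rule finite_subset[OF _ finite_words_length[of "length \<omega> + m"]])
     (auto simp: central_children_def)

text \<open>The radius is the side length of the spoke cubes, which fill the orthants around the
  center up to that distance in each coordinate.\<close>

lemma ball_center_subset_spokes:
  "ball (center c \<omega>) (side \<omega> / 2 ^ Suc k) \<subseteq> (\<Union>i\<in>letters n. dyadic_cube c (spoke \<omega> i k))"
proof
  fix y assume y: "y \<in> ball (center c \<omega>) (side \<omega> / 2 ^ Suc k)"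
  let ?x = "center c \<omega>"
  have near: "\<bar>y $ j - ?x $ j\<bar> < side \<omega> / 2 ^ Suc k" for j
    using y component_le_norm_cart[of "y - ?x" j] by (auto simp: dist_norm norm_minus_commute)
  \<comment> \<open>The letter names the orthant, seen from the center, that contains
    \<open>y\<close>.\<close>
  define i where "i = letter_of {j. ?x $ j \<le> y $ j}"
  have "y \<in> dyadic_cube c (spoke \<omega> i k)"
  proof (rule dyadic_cube_superset_box)
    fix j
    show "low c (spoke \<omega> i k) j \<le> y $ j" "y $ j < low c (spoke \<omega> i k) j + side (spoke \<omega> i k)"
      using near[of j] unfolding low_spoke side_spoke by (auto simp: i_def)
  qed
  then show "y \<in> (\<Union>i\<in>letters n. dyadic_cube c (spoke \<omega> i k))"
    by (auto simp: i_def)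
qed

lemma dyadic_cube_subset_ball:
  assumes "x \<in> dyadic_cube c \<omega>" "real CARD('d) * side \<omega> < r"
  shows "dyadic_cube c \<omega> \<subseteq> ball x r"
proof
  fix y assume y: "y \<in> dyadic_cube c \<omega>"
  have "norm (x - y) \<le> (\<Sum>j\<in>UNIV. \<bar>(x - y) $ j\<bar>)"
    by (rule norm_le_l1_cart)
  also have "\<dots> \<le> (\<Sum>j\<in>(UNIV::'d set). side \<omega>)"
  proof (intro sum_mono)
    fix j
    show "\<bar>(x - y) $ j\<bar> \<le> side \<omega>"
      using dyadic_cube_subset_box[OF assms(1), of j] dyadic_cube_subset_box[OF y, of j]
      by (simp add: abs_le_iff)
  qed
  also have "\<dots> = real CARD('d) * side \<omega>" by simp
  finally show "y \<in> ball x r"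
    using assms(2) by (simp add: dist_norm)
qed

lemma center_in_dyadic_cube: "center c \<omega> \<in> dyadic_cube c \<omega>"
  by (rule dyadic_cube_superset_box) (auto simp: center_def side_def field_simps)

end

subsection \<open>The uniform distribution on the simplex\<close>

text \<open>By Fubini in coordinate \<open>i\<close>: as \<open>g\<close> does not depend on it,
  every fibre of the exceptional set lies in a single point.\<close>

lemma AE_PiM_lborel_coordinate_neq:
  assumes "finite I" "i \<in> I"
    and [measurable]: "g \<in> borel_measurable (PiM I (\<lambda>_. lborel))"
    and g: "\<And>y z. g (y(i := z)) = g y"
  shows "AE y in PiM I (\<lambda>_. lborel). y i \<noteq> (g y :: real)"
proof -
  interpret product_sigma_finite "\<lambda>_. lborel :: real measure" ..
  let ?S = "{y \<in> space (PiM I (\<lambda>_. lborel)). y i = g y}"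
  have [measurable]: "(\<lambda>y. y i :: real) \<in> borel_measurable (PiM I (\<lambda>_. lborel))"
    using measurable_component_singleton[OF assms(2), of "\<lambda>_. lborel :: real measure"] by simp
  have S[measurable]: "?S \<in> sets (PiM I (\<lambda>_. lborel))"
    by measurable
  have I: "I = insert i (I - {i})" using assms(2) by auto
  have "emeasure (PiM I (\<lambda>_. lborel)) ?S = (\<integral>\<^sup>+ y. indicator ?S y \<partial>PiM I (\<lambda>_. lborel))"
    using S by (rule nn_integral_indicator[symmetric])
  also have "\<dots> = (\<integral>\<^sup>+ x. (\<integral>\<^sup>+ z. indicator ?S (x(i := z)) \<partial>lborel) \<partial>PiM (I - {i}) (\<lambda>_. lborel))"
    using product_nn_integral_insert[of "I - {i}" i "indicator ?S"] assms(1) S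
    unfolding I[symmetric] by simp
  also have "\<dots> \<le> (\<integral>\<^sup>+ x. (\<integral>\<^sup>+ z. indicator {g x} z \<partial>lborel) \<partial>PiM (I - {i}) (\<lambda>_. lborel))"
    by (intro nn_integral_mono) (auto simp: indicator_def g split: if_splits)
  also have "\<dots> = 0" by simp
  finally have "?S \<in> null_sets (PiM I (\<lambda>_. lborel))"
    using S by (intro null_setsI) auto
  then show ?thesis
    by (rule AE_I') auto
qed

lemma emeasure_PiM_lborel_cube:
  assumes "finite I" "a \<le> b"
  shows "emeasure (PiM I (\<lambda>_. lborel)) (Pi\<^sub>E I (\<lambda>_. {a..b::real})) = ennreal ((b - a) ^ card I)"
proof -
  interpret product_sigma_finite "\<lambda>_. lborel :: real measure" ..
  show ?thesis
    using assms by (subst emeasure_PiM) (auto simp: ennreal_power)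
qed

section \<open>The solid simplex as a chart for the uniform distribution\<close>

definition solid_simplex :: "nat \<Rightarrow> (nat \<Rightarrow> real) set" where
  "solid_simplex n = {y \<in> space (PiM {1..<n} (\<lambda>_. lborel)).
                 (\<forall>i\<in>{1..<n}. 0 \<le> y i) \<and> (\<Sum>i\<in>{1..<n}. y i) \<le> 1}"

definition simplex_embedding :: "nat \<Rightarrow> (nat \<Rightarrow> real) \<Rightarrow> nat \<Rightarrow> real" where
  "simplex_embedding n = (\<lambda>y. \<lambda>i\<in>letters n. if i < n then y i else 1 - (\<Sum>k\<in>{1..<n}. y k))"

lemma simplex_uniform_eq:
  "simplex_uniform n = distr (uniform_measure (PiM {1..<n} (\<lambda>_. lborel)) (solid_simplex n))
     (PiM (letters n) (\<lambda>_. borel)) (simplex_embedding n)"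
  by (simp add: simplex_uniform_def solid_simplex_def simplex_embedding_def)

lemma measurable_coordinate_PiM_lborel:
  "i \<in> I \<Longrightarrow> (\<lambda>y. y i :: real) \<in> borel_measurable (PiM I (\<lambda>_. lborel))"
  using measurable_component_singleton[of i I "\<lambda>_. lborel :: real measure"] by simp

lemma solid_simplex_sets: "solid_simplex n \<in> sets (PiM {1..<n} (\<lambda>_. lborel))"
proof -
  note [measurable] = measurable_coordinate_PiM_lborel
  show ?thesis
    unfolding solid_simplex_def by measurable
qed

lemma simplex_embedding_measurable:
  "simplex_embedding n \<in> PiM {1..<n} (\<lambda>_. lborel) \<rightarrow>\<^sub>M PiM (letters n) (\<lambda>_. borel)"
  unfolding simplex_embedding_def
proof (rule measurable_restrict)
  fix i assume i: "i \<in> letters n"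
  show "(\<lambda>y. if i < n then y i else 1 - (\<Sum>k\<in>{1..<n}. y k))
      \<in> borel_measurable (PiM {1..<n} (\<lambda>_. lborel :: real measure))"
  proof (cases "i < n")
    case True
    then show ?thesis using i by (simp add: letters_def measurable_coordinate_PiM_lborel)
  next
    case False
    then show ?thesis
      by (auto intro!: borel_measurable_diff borel_measurable_sum measurable_coordinate_PiM_lborel)
  qed
qed

lemma solid_simplex_le_1:
  assumes "y \<in> solid_simplex n" "i \<in> {1..<n}"
  shows "y i \<le> 1"
proof -
  have "y i \<le> (\<Sum>i\<in>{1..<n}. y i)"
    using assms by (intro member_le_sum) (auto simp: solid_simplex_def)
  then show ?thesis using assms(1) by (simp add: solid_simplex_def)
qed

lemma AE_simplex_uniform:
  assumes "2 \<le> n"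
  shows "AE y in simplex_uniform n. \<forall>i\<in>letters n. 0 < y i \<and> y i \<le> 1"
proof -
  let ?L = "PiM {1..<n} (\<lambda>_. lborel :: real measure)"
  have "AE y in ?L. \<forall>i\<in>{1..<n}. y i \<noteq> 0"
    by (intro AE_finite_allI) (auto intro: AE_PiM_lborel_coordinate_neq)
  \<comment> \<open>The last barycentric coordinate vanishes only on a hyperplane, here solved for
    \<open>y 1\<close>, a coordinate that exists because \<open>2 \<le> n\<close>.\<close>
  moreover have "AE y in ?L. y 1 \<noteq> 1 - (\<Sum>k\<in>{1..<n} - {1}. y k)"
    using assms
    by (intro AE_PiM_lborel_coordinate_neq)
       (auto intro!: borel_measurable_diff borel_measurable_sum measurable_coordinate_PiM_lborel sum.cong)
  ultimately have "AE y in ?L. y \<in> solid_simplex n \<longrightarrow>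
      (\<forall>i\<in>letters n. 0 < simplex_embedding n y i \<and> simplex_embedding n y i \<le> 1)"
  proof eventually_elim
    case (elim y)
    show ?case
    proof (intro impI ballI)
      fix i assume y: "y \<in> solid_simplex n" and i: "i \<in> letters n"
      show "0 < simplex_embedding n y i \<and> simplex_embedding n y i \<le> 1"
      proof (cases "i < n")
        case True
        then have "i \<in> {1..<n}" using i by (auto simp: letters_def)
        then have "0 \<le> y i" "y i \<noteq> 0" "y i \<le> 1"
          using y elim(1) solid_simplex_le_1[OF y] by (auto simp: solid_simplex_def)
        then show ?thesis using True i by (auto simp: simplex_embedding_def)
      next
        case False
        have "(\<Sum>k\<in>{1..<n}. y k) = y 1 + (\<Sum>k\<in>{1..<n} - {1}. y k)"
          using assms by (intro sum.remove) auto
        then have "(\<Sum>k\<in>{1..<n}. y k) \<noteq> 1" using elim(2) by linarith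
        moreover have "(\<Sum>k\<in>{1..<n}. y k) \<ge> 0"
          using y by (intro sum_nonneg) (auto simp: solid_simplex_def)
        moreover have "(\<Sum>k\<in>{1..<n}. y k) \<le> 1"
          using y by (auto simp: solid_simplex_def)
        ultimately show ?thesis using False i by (auto simp: simplex_embedding_def)
      qed
    qed
  qed
  then have "AE y in uniform_measure ?L (solid_simplex n).
      \<forall>i\<in>letters n. 0 < simplex_embedding n y i \<and> simplex_embedding n y i \<le> 1"
    by (intro AE_uniform_measureI solid_simplex_sets)
  moreover have "{y \<in> space (PiM (letters n) (\<lambda>_. borel)). \<forall>i\<in>letters n. 0 < y i \<and> y i \<le> (1::real)}
      \<in> sets (PiM (letters n) (\<lambda>_. borel))"
    by (rule sets.sets_Collect_finite_All) (auto simp: letters_def)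
  ultimately show ?thesis
    unfolding simplex_uniform_eq using simplex_embedding_measurable
    by (subst AE_distr_iff) auto
qed

lemma simplex_uniform_small_coordinate:
  assumes n: "2 \<le> n" and i: "i \<in> letters n" and e: "0 < e" "e < 1"
  shows "0 < emeasure (simplex_uniform n) {y \<in> space (PiM (letters n) (\<lambda>_. borel)). y i \<le> e}"
proof -
  let ?L = "PiM {1..<n} (\<lambda>_. lborel :: real measure)"
  define T where "T = {y \<in> space (PiM (letters n) (\<lambda>_. borel)). y i \<le> e}"
  have T: "T \<in> sets (PiM (letters n) (\<lambda>_. borel))"
    unfolding T_def using i by measurable
  \<comment> \<open>A cube on which the \<open>i\<close>-th barycentric coordinate is small: near the origin for \<open>i < n\<close>,
    near the opposite face for \<open>i = n\<close>.\<close>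
  define a where "a = (if i < n then 0 else (1 - e) / (n - 1))"
  define b where "b = (if i < n then e / (n - 1) else 1 / (n - 1))"
  define box where "box = (Pi\<^sub>E {1..<n} (\<lambda>_. {a..b}))"
  have n1: "0 < real (n - 1)" using n by simp
  have ab: "0 \<le> a" "a < b" using e n1 by (auto simp: a_def b_def divide_strict_right_mono)
  have b1: "real (n - 1) * b \<le> 1" using e n1 by (simp add: b_def del: of_nat_diff)
  have box_sum: "(\<Sum>k\<in>{1..<n}. y k) \<le> real (n - 1) * b" "real (n - 1) * a \<le> (\<Sum>k\<in>{1..<n}. y k)"
    if "y \<in> box" for y
    using that sum_bounded_above[of "{1..<n}" y b] sum_bounded_below[of "{1..<n}" a y]
    by (auto simp: box_def PiE_def Pi_def)
  have box_sub: "box \<subseteq> solid_simplex n"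
  proof
    fix y assume y: "y \<in> box"
    have "y \<in> space ?L" using y by (auto simp: box_def space_PiM)
    moreover have "\<forall>k\<in>{1..<n}. 0 \<le> y k" using y ab by (auto simp: box_def PiE_def Pi_def)
    ultimately show "y \<in> solid_simplex n"
      using box_sum(1)[OF y] b1 by (auto simp: solid_simplex_def)
  qed
  have box_T: "simplex_embedding n y \<in> T" if y: "y \<in> box" for y
  proof -
    have "simplex_embedding n y \<in> space (PiM (letters n) (\<lambda>_. borel))"
      by (auto simp: simplex_embedding_def space_PiM)
    moreover have "simplex_embedding n y i \<le> e"
    proof (cases "i < n")
      case True
      then have "y i \<le> b" using y i by (auto simp: box_def PiE_def Pi_def letters_def)
      also have "b \<le> e" using True e n frac_le[of e e 1 "real (n - 1)"] by (auto simp: b_def)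
      finally show ?thesis using True i by (simp add: simplex_embedding_def)
    next
      case False
      then show ?thesis
        using box_sum(2)[OF y] i n1 by (auto simp: simplex_embedding_def a_def)
    qed
    ultimately show ?thesis by (simp add: T_def)
  qed
  let ?V = "simplex_embedding n -` T \<inter> space ?L"
  have V: "?V \<in> sets ?L"
    using simplex_embedding_measurable T by (rule measurable_sets)
  \<comment> \<open>The volume has to be finite, since dividing by an infinite one would give
    0.\<close>
  have "solid_simplex n \<subseteq> Pi\<^sub>E {1..<n} (\<lambda>_. {0..1})"
    using solid_simplex_le_1[of _ n] by (auto simp: solid_simplex_def space_PiM PiE_def)
  then have "emeasure ?L (solid_simplex n) \<le> emeasure ?L (Pi\<^sub>E {1..<n} (\<lambda>_. {0..1}))"
    by (rule emeasure_mono) (auto intro!: sets_PiM_I_finite)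
  also have "\<dots> = 1" by (simp add: emeasure_PiM_lborel_cube)
  finally have le1: "emeasure ?L (solid_simplex n) \<le> 1" .
  have "0 < emeasure ?L box"
    using ab by (simp add: box_def emeasure_PiM_lborel_cube)
  also have "\<dots> \<le> emeasure ?L (solid_simplex n \<inter> ?V)"
    using box_sub box_T V solid_simplex_sets[of n]
    by (intro emeasure_mono) (auto simp: solid_simplex_def)
  finally have "0 < emeasure ?L (solid_simplex n \<inter> ?V) / emeasure ?L (solid_simplex n)"
    using order.strict_trans1[OF le1 ennreal_one_less_top] by (simp add: ennreal_zero_less_divide)
  also have "\<dots> = emeasure (uniform_measure ?L (solid_simplex n)) ?V"
    using V solid_simplex_sets by simp
  also have "\<dots> = emeasure (simplex_uniform n) T"
    unfolding simplex_uniform_eq using T simplex_embedding_measurable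
    by (subst emeasure_distr) auto
  finally show ?thesis by (simp add: T_def)
qed

subsection \<open>Cubes with small labels towards the center\<close>

lemma one_minus_power_le_exp:
  assumes "0 \<le> p" "p \<le> (1::real)"
  shows "(1 - p) ^ k \<le> exp (- (p * real k))"
proof -
  have "(1 - p) ^ k \<le> exp (- p) ^ k"
    using assms exp_ge_add_one_self[of "- p"] by (intro power_mono) auto
  also have "\<dots> = exp (- (p * real k))"
    by (simp add: exp_of_nat_mult[symmetric] mult.commute)
  finally show ?thesis .
qed

section \<open>Independent labels, and levels without small spokes\<close>

locale cascade_labels = dyadic_coding n c + prob_space M
  for n :: nat and c :: "nat \<Rightarrow> ('d::finite) set" and M :: "'a measure" +
  fixes X :: "nat list \<Rightarrow> 'a \<Rightarrow> nat \<Rightarrow> real"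
  assumes indep: "indep_vars (\<lambda>_. PiM (letters n) (\<lambda>_. borel)) X (words n)"
    and distr_label: "\<And>v. v \<in> words n \<Longrightarrow>
      distr M (PiM (letters n) (\<lambda>_. borel)) (X v) = simplex_uniform n"
begin

lemma measurable_label: "v \<in> words n \<Longrightarrow> X v \<in> M \<rightarrow>\<^sub>M PiM (letters n) (\<lambda>_. borel)"
  using indep by (auto simp: indep_vars_def)

lemma measurable_label_coordinate:
  "v \<in> words n \<Longrightarrow> i \<in> letters n \<Longrightarrow> (\<lambda>x. X v x i) \<in> borel_measurable M"
  by (rule measurable_compose[OF measurable_label measurable_component_singleton])

lemma AE_label_bounds: "AE x in M. \<forall>v\<in>words n. \<forall>i\<in>letters n. 0 < X v x i \<and> X v x i \<le> 1"
proof (subst AE_ball_countable)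
  show "countable (words n)" by (rule countable_subset[OF subset_UNIV]) simp
  show "\<forall>v\<in>words n. AE x in M. \<forall>i\<in>letters n. 0 < X v x i \<and> X v x i \<le> 1"
  proof
    fix v assume v: "v \<in> words n"
    show "AE x in M. \<forall>i\<in>letters n. 0 < X v x i \<and> X v x i \<le> 1"
      by (rule AE_distrD[OF measurable_label[OF v]])
        (simp only: distr_label[OF v] AE_simplex_uniform[OF n_ge_2])
  qed
qed

text \<open>All label vectors have the same law, so a minimum over the finitely many letters is
  uniform over the words too.\<close>

lemma uniform_small_label_bound:
  assumes "0 < e" "e < 1"
  obtains q where "0 < q" "q \<le> 1"
    "\<And>v i. v \<in> words n \<Longrightarrow> i \<in> letters n \<Longrightarrow> q \<le> prob {x \<in> space M. X v x i \<le> e}"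
proof -
  define S where "S i = {y \<in> space (PiM (letters n) (\<lambda>_. borel)). y i \<le> e}" for i
  have S: "S i \<in> sets (PiM (letters n) (\<lambda>_. borel))" if "i \<in> letters n" for i
    unfolding S_def using that by measurable
  have eq: "prob {x \<in> space M. X v x i \<le> e} = measure (simplex_uniform n) (S i)"
    if v: "v \<in> words n" and i: "i \<in> letters n" for v i
  proof -
    have "measure (simplex_uniform n) (S i) = prob (X v -` S i \<inter> space M)"
      unfolding distr_label[OF v, symmetric]
      by (rule measure_distr[OF measurable_label[OF v] S[OF i]])
    also have "X v -` S i \<inter> space M = {x \<in> space M. X v x i \<le> e}"
      using measurable_space[OF measurable_label[OF v]] by (auto simp: S_def)
    finally show ?thesis by simp
  qed
  define q where "q = Min ((\<lambda>i. measure (simplex_uniform n) (S i)) ` letters n)"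
  have ne: "letters n \<noteq> {}" using n_ge_2 by (auto simp: letters_def)
  have nil: "[] \<in> words n" by simp
  have pos: "0 < measure (simplex_uniform n) (S i)" if i: "i \<in> letters n" for i
  proof -
    interpret D: prob_space "simplex_uniform n"
      unfolding distr_label[OF nil, symmetric]
      by (rule prob_space_distr[OF measurable_label[OF nil]])
    show ?thesis
      using simplex_uniform_small_coordinate[OF n_ge_2 i assms]
      by (simp add: S_def D.emeasure_eq_measure)
  qed
  show thesis
  proof
    show "0 < q" unfolding q_def using ne pos by (subst Min_gr_iff) auto
    show le: "q \<le> prob {x \<in> space M. X v x i \<le> e}" if "v \<in> words n" "i \<in> letters n" for v i
      unfolding eq[OF that] q_def using that by (intro Min_le) auto
    show "q \<le> 1"
      using le[OF nil letter_of(1)] prob_le_1 order_trans by blast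
  qed
qed

text \<open>The edge from \<omega> to its child is left free, because the labels at \<omega> sum to
  1 and cannot all be small. The conditions concern the next \<open>m\<close> edges of each
  spoke.\<close>

definition small_spokes :: "real \<Rightarrow> nat \<Rightarrow> nat list \<Rightarrow> 'a set" where
  "small_spokes e m \<omega> =
     {x \<in> space M. \<forall>i\<in>letters n. \<forall>k<m. X (spoke \<omega> i k) x (letter_of (- c i)) \<le> e}"

definition spokes :: "nat \<Rightarrow> nat list \<Rightarrow> nat list set" where
  "spokes m \<omega> = (\<lambda>(i, k). spoke \<omega> i k) ` (letters n \<times> {..<m})"

text \<open>The first step after \<omega> can be read off the vertex, so the conditions can be
  indexed by vertices alone, just like the independent label vectors.\<close>

definition spoke_letter :: "nat list \<Rightarrow> nat list \<Rightarrow> nat" where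
  "spoke_letter \<omega> v = letter_of (- c (v ! length \<omega>))"

lemma spoke_letter_spoke [simp]: "spoke_letter \<omega> (spoke \<omega> i k) = letter_of (- c i)"
  by (simp add: spoke_letter_def spoke_def)

lemma spoke_letter_letters [simp]: "spoke_letter \<omega> v \<in> letters n"
  by (simp add: spoke_letter_def)

lemma finite_spokes [simp]: "finite (spokes m \<omega>)"
  by (simp add: spokes_def)

lemma spokes_words:
  assumes "\<omega> \<in> words n"
  shows "spokes m \<omega> \<subseteq> words n"
proof
  fix v assume "v \<in> spokes m \<omega>"
  then obtain i k where i: "i \<in> letters n" and v: "v = spoke \<omega> i k"
    by (auto simp: spokes_def)
  show "v \<in> words n" unfolding v by (rule spoke_words[OF assms i])
qed

lemma small_spokes_eq:
  "small_spokes e m \<omega> = {x \<in> space M. \<forall>v\<in>spokes m \<omega>. X v x (spoke_letter \<omega> v) \<le> e}"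
  by (auto simp: small_spokes_def spokes_def)

lemma small_spokes_sets: "\<omega> \<in> words n \<Longrightarrow> small_spokes e m \<omega> \<in> sets M"
  unfolding small_spokes_eq
proof (rule sets.sets_Collect_finite_All[OF _ finite_spokes])
  fix v assume "\<omega> \<in> words n" "v \<in> spokes m \<omega>"
  then have "v \<in> words n" using spokes_words by blast
  then have [measurable]: "(\<lambda>x. X v x (spoke_letter \<omega> v)) \<in> borel_measurable M"
    by (rule measurable_label_coordinate) simp
  show "{x \<in> space M. X v x (spoke_letter \<omega> v) \<le> e} \<in> sets M"
    by measurable
qed

text \<open>There is one condition per vertex on the spokes, hence at most \<open>n * m\<close>
  independent conditions, each of probability at least \<open>q\<close>.\<close>

lemma prob_small_spokes:
  assumes q: "0 < q" "q \<le> 1"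
    "\<And>v i. v \<in> words n \<Longrightarrow> i \<in> letters n \<Longrightarrow> q \<le> prob {x \<in> space M. X v x i \<le> e}"
    and w: "\<omega> \<in> words n"
  shows "q ^ (n * m) \<le> prob (small_spokes e m \<omega>)"
proof (cases "spokes m \<omega> = {}")
  \<comment> \<open>This is the case \<open>m = 0\<close>, kept apart because the product formula
    for independent events is applied to a nonempty index set.\<close>
  case True
  then have "small_spokes e m \<omega> = space M" by (simp add: small_spokes_eq)
  then show ?thesis using q(1,2) by (simp add: prob_space power_le_one)
next
  case False
  define A where "A v = {y \<in> space (PiM (letters n) (\<lambda>_. borel)). y (spoke_letter \<omega> v) \<le> e}" for v
  have A: "A v \<in> sets (PiM (letters n) (\<lambda>_. borel))" for v
    unfolding A_def by measurable
  have vim: "X v -` A v \<inter> space M = {x \<in> space M. X v x (spoke_letter \<omega> v) \<le> e}"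
    if "v \<in> spokes m \<omega>" for v
  proof -
    have "v \<in> words n" using that spokes_words[OF w] by blast
    from measurable_space[OF measurable_label[OF this]] show ?thesis
      by (auto simp: A_def)
  qed
  have card: "card (spokes m \<omega>) \<le> n * m"
    using card_image_le[of "letters n \<times> {..<m}" "\<lambda>(i, k). spoke \<omega> i k"]
    by (simp add: spokes_def card_letters)
  have "q ^ (n * m) \<le> q ^ card (spokes m \<omega>)"
    using q(1,2) card by (intro power_decreasing) auto
  also have "\<dots> = (\<Prod>v\<in>spokes m \<omega>. q)" by simp
  also have "\<dots> \<le> (\<Prod>v\<in>spokes m \<omega>. prob (X v -` A v \<inter> space M))"
    using q(1) q(3)[OF subsetD[OF spokes_words[OF w]] spoke_letter_letters] by (intro prod_mono) (simp add: vim less_imp_le)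
  also have "\<dots> = prob (\<Inter>v\<in>spokes m \<omega>. X v -` A v \<inter> space M)"
    using False spokes_words[OF w] A by (intro indep_varsD[OF indep, symmetric]) auto
  also have "(\<Inter>v\<in>spokes m \<omega>. X v -` A v \<inter> space M) = small_spokes e m \<omega>"
    using False by (auto simp: vim small_spokes_eq)
  finally show ?thesis .
qed

text \<open>The first \<open>l\<close> letters of a vertex on a spoke already determine the cube
  that it starts from.\<close>

lemma disjoint_spokes: "disjoint_family_on (spokes m) {\<omega> \<in> words n. length \<omega> = l}"
  unfolding disjoint_family_on_def
proof (intro ballI impI)
  fix u v assume uv: "u \<in> {\<omega> \<in> words n. length \<omega> = l}" "v \<in> {\<omega> \<in> words n. length \<omega> = l}" "u \<noteq> v"
  have "take l w = u" if "w \<in> spokes m u" for w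
    using that uv(1) by (auto simp: spokes_def spoke_def)
  moreover have "take l w = v" if "w \<in> spokes m v" for w
    using that uv(2) by (auto simp: spokes_def spoke_def)
  ultimately show "spokes m u \<inter> spokes m v = {}" using uv(3) by auto
qed

text \<open>Different cubes of one level involve disjoint sets of label vectors. Grouped into one
  block per cube, these are again independent, so the probabilities of failure multiply.\<close>

lemma prob_no_small_spokes:
  assumes q: "0 < q" "q \<le> 1"
    "\<And>v i. v \<in> words n \<Longrightarrow> i \<in> letters n \<Longrightarrow> q \<le> prob {x \<in> space M. X v x i \<le> e}"
  shows "prob (space M - (\<Union>\<omega>\<in>{\<omega> \<in> words n. length \<omega> = l}. small_spokes e m \<omega>))
           \<le> (1 - q ^ (n * m)) ^ (n ^ l)"
proof -
  let ?W = "{\<omega> \<in> words n. length \<omega> = l}"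
  let ?N = "\<lambda>\<omega>. PiM (spokes m \<omega>) (\<lambda>_. PiM (letters n) (\<lambda>_. borel :: real measure))"
  let ?Y = "\<lambda>\<omega> x. restrict (\<lambda>v. X v x) (spokes m \<omega>)"
  have "replicate l (letter_of UNIV) \<in> ?W" by (auto simp: in_lists_conv_set)
  then have ne: "?W \<noteq> {}" by blast
  have ind: "indep_vars ?N ?Y ?W"
    using spokes_words disjoint_spokes by (intro indep_vars_restrict[OF indep]) auto
  define S where "S \<omega> = {f \<in> space (?N \<omega>). \<not> (\<forall>v\<in>spokes m \<omega>. f v (spoke_letter \<omega> v) \<le> e)}" for \<omega>
  have S: "S \<omega> \<in> sets (?N \<omega>)" for \<omega>
    unfolding S_def
  proof (intro sets.sets_Collect_neg sets.sets_Collect_finite_All[OF _ finite_spokes])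
    fix v assume v: "v \<in> spokes m \<omega>"
    have [measurable]: "(\<lambda>f. f v (spoke_letter \<omega> v)) \<in> borel_measurable (?N \<omega>)"
      by (rule measurable_compose[where N = "PiM (letters n) (\<lambda>_. borel)",
            OF measurable_component_singleton[OF v]
              measurable_component_singleton[OF spoke_letter_letters]])
    show "{f \<in> space (?N \<omega>). f v (spoke_letter \<omega> v) \<le> e} \<in> sets (?N \<omega>)"
      by (rule borel_measurable_le) simp_all
  qed
  have Y: "?Y \<omega> x \<in> space (?N \<omega>)" if "\<omega> \<in> ?W" "x \<in> space M" for \<omega> x
  proof -
    have "X v x \<in> space (PiM (letters n) (\<lambda>_. borel))" if "v \<in> spokes m \<omega>" for v
      using measurable_space[OF measurable_label] spokes_words[of \<omega> m] \<open>\<omega> \<in> ?W\<close> \<open>x \<in> space M\<close> that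
      by blast
    then show ?thesis unfolding space_PiM[of "spokes m \<omega>"] by simp
  qed
  have vim: "?Y \<omega> -` S \<omega> \<inter> space M = space M - small_spokes e m \<omega>" if "\<omega> \<in> ?W" for \<omega>
    using Y[OF that] by (auto simp: S_def small_spokes_eq)
  have "space M - (\<Union>\<omega>\<in>?W. small_spokes e m \<omega>) = (\<Inter>\<omega>\<in>?W. ?Y \<omega> -` S \<omega> \<inter> space M)"
    using ne by (subst INF_cong[OF refl vim]) auto
  then have "prob (space M - (\<Union>\<omega>\<in>?W. small_spokes e m \<omega>)) = prob (\<Inter>\<omega>\<in>?W. ?Y \<omega> -` S \<omega> \<inter> space M)"
    by simp
  also have "\<dots> = (\<Prod>\<omega>\<in>?W. prob (?Y \<omega> -` S \<omega> \<inter> space M))"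
    using ne S finite_words_length by (intro indep_varsD_finite[OF ind]) auto
  also have "\<dots> = (\<Prod>\<omega>\<in>?W. 1 - prob (small_spokes e m \<omega>))"
    by (intro prod.cong refl) (auto simp: vim small_spokes_sets prob_compl)
  also have "\<dots> \<le> (\<Prod>\<omega>\<in>?W. 1 - q ^ (n * m))"
    using prob_small_spokes[OF q] by (intro prod_mono) (simp add: prob_le_1)
  also have "\<dots> = (1 - q ^ (n * m)) ^ (n ^ l)"
    by (simp only: prod_constant card_words_length)
  finally show ?thesis .
qed

lemma AE_eventually_small_spokes:
  assumes "0 < e" "e < 1"
  obtains N :: nat where "0 < N"
    "\<And>\<delta>. 0 < \<delta> \<Longrightarrow> \<delta> \<le> 1 / real N \<Longrightarrow>
       AE x in M. \<forall>\<^sub>F m in sequentially. \<exists>\<omega>\<in>words n. length \<omega> = nat \<lfloor>real m / \<delta>\<rfloor> \<and> x \<in> small_spokes e m \<omega>"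
proof -
  obtain q where q: "0 < q" "q \<le> 1"
    "\<And>v i. v \<in> words n \<Longrightarrow> i \<in> letters n \<Longrightarrow> q \<le> prob {x \<in> space M. X v x i \<le> e}"
    using uniform_small_label_bound[OF assms] by metis
  \<comment> \<open>If \<delta> is at most \<open>1 / N\<close>, a level has at least
    \<open>2 ^ (N * m)\<close> cubes. The choice \<open>q ^ n * 2 ^ N \<ge> 2\<close> makes their
    number times the probability \<open>q ^ (n * m)\<close> at least \<open>2 ^ m\<close>.\<close>
  obtain N0 where "2 / q ^ n < 2 ^ N0" using real_arch_pow[of 2 "2 / q ^ n"] by auto
  then have N0: "2 \<le> q ^ n * 2 ^ N0" using q(1) by (simp add: field_simps)
  define N where "N = Suc N0"
  have N: "2 \<le> q ^ n * 2 ^ N" using N0 q(1) by (simp add: N_def)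
  show thesis
  proof
    show "0 < N" by (simp add: N_def)
    fix \<delta> :: real assume d: "0 < \<delta>" "\<delta> \<le> 1 / real N"
    define l where "l m = nat \<lfloor>real m / \<delta>\<rfloor>" for m
    define B where "B m = space M - (\<Union>\<omega>\<in>{\<omega> \<in> words n. length \<omega> = l m}. small_spokes e m \<omega>)" for m
    have B: "B m \<in> sets M" for m
      unfolding B_def using finite_words_length small_spokes_sets
      by (intro sets.compl_sets sets.finite_UN) auto
    have le: "prob (B m) \<le> (1 / 2) ^ m" for m
    proof -
      have "real N * real m \<le> real m / \<delta>"
        using d mult_right_mono[of "real N" "1 / \<delta>" "real m"] by (simp add: N_def field_simps)
      then have "N * m \<le> l m" unfolding l_def by (simp add: le_nat_floor)
      then have "2 ^ (N * m) \<le> n ^ l m"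
        using n_ge_2 by (intro order_trans[OF power_mono power_increasing]) auto
      then have l: "2 ^ (N * m) \<le> real (n ^ l m)"
        by (metis of_nat_le_iff of_nat_numeral of_nat_power)
      have "(2::real) ^ m \<le> (q ^ n * 2 ^ N) ^ m"
        using N by (intro power_mono) auto
      also have "\<dots> = q ^ (n * m) * 2 ^ (N * m)"
        by (simp add: power_mult power_mult_distrib)
      also have "\<dots> \<le> q ^ (n * m) * real (n ^ l m)"
        using l q(1) by (intro mult_left_mono) auto
      finally have big: "2 ^ m \<le> q ^ (n * m) * real (n ^ l m)" .
      have "prob (B m) \<le> (1 - q ^ (n * m)) ^ (n ^ l m)"
        unfolding B_def by (rule prob_no_small_spokes[OF q])
      also have "\<dots> \<le> exp (- (q ^ (n * m) * real (n ^ l m)))"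
        using q(1,2) by (intro one_minus_power_le_exp) (auto simp: power_le_one)
      also have "\<dots> \<le> exp (- (2 ^ m))" using big by simp
      also have "\<dots> = inverse (exp (2 ^ m))" by (rule exp_minus)
      also have "\<dots> \<le> inverse (2 ^ m)"
        using exp_ge_add_one_self[of "2 ^ m"] by (intro le_imp_inverse_le) (linarith, simp)
      finally show ?thesis by (simp add: power_one_over inverse_eq_divide)
    qed
    \<comment> \<open>The failure probabilities are dominated by a geometric series, as
      Borel-Cantelli requires.\<close>
    have "summable (\<lambda>m. prob (B m))"
      by (rule summable_comparison_test'[of "\<lambda>m. (1 / 2) ^ m" 0]) (auto simp: le summable_geometric)
    then have "AE x in M. \<forall>\<^sub>F m in sequentially. x \<in> space M - B m"
      using B by (intro borel_cantelli_AE1) (auto simp: emeasure_eq_measure)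
    then show "AE x in M. \<forall>\<^sub>F m in sequentially.
        \<exists>\<omega>\<in>words n. length \<omega> = nat \<lfloor>real m / \<delta>\<rfloor> \<and> x \<in> small_spokes e m \<omega>"
    proof eventually_elim
      case (elim x)
      then show ?case
        by (rule eventually_mono) (auto simp: B_def l_def)
    qed
  qed
qed

end

subsection \<open>Consequences of small mass around the center\<close>

lemma in_cube_probD:
  assumes "\<nu> \<in> space cube_prob"
  shows "prob_space \<nu>" "sets \<nu> = sets (restrict_space borel unit_cube)" "space \<nu> = unit_cube"
proof -
  show "prob_space \<nu>" and sets: "sets \<nu> = sets (restrict_space borel unit_cube)"
    using assms by (auto simp: cube_prob_def space_prob_algebra)
  show "space \<nu> = unit_cube"
    using sets_eq_imp_space_eq[OF sets] by (simp add: space_restrict_space)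
qed

section \<open>Measurability on the space of measures\<close>

lemma measurable_mass:
  "(\<lambda>\<nu>. measure \<nu> (dyadic_cube c w)) \<in> borel_measurable (cube_prob :: (real ^ 'd::finite) measure measure)"
  unfolding cube_prob_def by (rule measurable_measure_prob_algebra[OF dyadic_cube_sets])

lemma measurable_mass_ratio:
  "(\<lambda>\<nu>. mass_ratio c \<nu> w w') \<in> borel_measurable (cube_prob :: (real ^ 'd::finite) measure measure)"
proof -
  note [measurable] = measurable_mass
  show ?thesis unfolding mass_ratio_def by measurable
qed

lemma measurable_elog2: "elog2 \<in> borel_measurable borel"
  unfolding elog2_def by measurable

lemma elog2_ge:
  assumes "ereal (2 ^ k) \<le> x"
  shows "ereal (real k) \<le> elog2 x"
proof (cases x)
  case (real r)
  then have "2 ^ k \<le> r" using assms by simp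
  moreover have "0 < r" using calculation by (rule less_le_trans[rotated]) simp
  ultimately have "real k \<le> log 2 r" by (simp add: le_log_iff powr_realpow)
  then show ?thesis using real by (simp add: elog2_def)
qed (use assms in \<open>auto simp: elog2_def\<close>)

section \<open>Lower bounds for H and for the quasi-Assouad exponent\<close>

context dyadic_coding
begin

lemma measurable_H_max:
  "(\<lambda>\<nu>. H_max n c m \<delta> \<nu>) \<in> borel_measurable (cube_prob :: (real ^ 'd) measure measure)"
  unfolding H_max_def
  by (intro borel_measurable_Max borel_measurable_Min finite_words_length finite_central_children
      measurable_mass_ratio)

text \<open>This property of the measure alone links the random labels to both conclusions. The
  index \<open>m - 1\<close> gives words of length \<open>length \<omega> + m\<close>, the level of
  the central children; the product form avoids division by zero masses.\<close>

definition center_deficient :: "nat \<Rightarrow> real \<Rightarrow> (real ^ 'd) measure \<Rightarrow> bool" where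
  "center_deficient A \<delta> \<nu> \<longleftrightarrow>
     (\<forall>\<^sub>F m in sequentially. \<exists>\<omega>\<in>words n. length \<omega> = nat \<lfloor>real m / \<delta>\<rfloor> \<and>
        (\<forall>i\<in>letters n. measure \<nu> (dyadic_cube c (spoke \<omega> i (m - 1))) * 2 ^ (A * m)
            \<le> measure \<nu> (dyadic_cube c \<omega>)))"

lemma sets_center_deficient: "{\<nu> \<in> space cube_prob. center_deficient A \<delta> \<nu>} \<in> sets cube_prob"
proof -
  note [measurable] = measurable_mass
  show ?thesis
    unfolding center_deficient_def eventually_sequentially by measurable
qed

text \<open>Every central child ends a spoke, so one deficient cube bounds its whole minimum from
  below by \<open>2 ^ (A * m)\<close>, and the maximum is at least that.\<close>

lemma center_deficient_H_max:
  assumes "center_deficient A \<delta> \<nu>"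
  shows "ereal (real A) \<le> limsup (\<lambda>m. elog2 (H_max n c m \<delta> \<nu>) / ereal (real m))"
proof -
  have "\<forall>\<^sub>F m in sequentially. ereal (real A) \<le> elog2 (H_max n c m \<delta> \<nu>) / ereal (real m)"
    using assms[unfolded center_deficient_def] eventually_gt_at_top[of 0]
  proof eventually_elim
    case (elim m)
    then obtain \<omega> where w: "\<omega> \<in> words n" "length \<omega> = nat \<lfloor>real m / \<delta>\<rfloor>"
      and small: "\<And>i. i \<in> letters n \<Longrightarrow>
        measure \<nu> (dyadic_cube c (spoke \<omega> i (m - 1))) * 2 ^ (A * m) \<le> measure \<nu> (dyadic_cube c \<omega>)"
      by blast
    have m: "Suc (m - 1) = m" using elim by simp
    have ratio: "ereal (2 ^ (A * m)) \<le> mass_ratio c \<nu> \<omega> w'" if "w' \<in> central_children n c m \<omega>" for w'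
    proof -
      have "w' \<in> (\<lambda>i. spoke \<omega> i (m - 1)) ` letters n"
        using central_children_subset_spokes[of "m - 1" \<omega>] that unfolding m by blast
      then have "measure \<nu> (dyadic_cube c w') * 2 ^ (A * m) \<le> measure \<nu> (dyadic_cube c \<omega>)"
        using small by auto
      moreover have "0 \<le> measure \<nu> (dyadic_cube c w')" by simp
      \<comment> \<open>A central child of mass 0 has ratio \<infinity> by convention; otherwise the
        product form is divided out.\<close>
      ultimately show ?thesis
        by (auto simp: mass_ratio_def pos_le_divide_eq mult.commute less_le)
    qed
    have "central_children n c m \<omega> \<noteq> {}"
      using upper_spoke_central[OF w(1), of "m - 1"] unfolding m by blast
    then have "ereal (2 ^ (A * m)) \<le> (MIN w'\<in>central_children n c m \<omega>. mass_ratio c \<nu> \<omega> w')"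
      using ratio finite_central_children by (subst Min_ge_iff) auto
    also have "\<dots> \<le> H_max n c m \<delta> \<nu>"
      unfolding H_max_def using finite_words_length w
      by (intro Max_ge finite_imageI imageI) auto
    finally have "ereal (real (A * m)) \<le> elog2 (H_max n c m \<delta> \<nu>)"
      by (rule elog2_ge)
    then show ?case
      using elim by (subst ereal_le_divide_pos) (auto simp: mult.commute)
  qed
  then have "limsup (\<lambda>m. ereal (real A)) \<le> limsup (\<lambda>m. elog2 (H_max n c m \<delta> \<nu>) / ereal (real m))"
    by (rule Limsup_mono)
  then show ?thesis by (simp add: Limsup_const)
qed

text \<open>The cubes at the ends of the all-upper spokes contain the center, shrink to it and have
  positive mass.\<close>

lemma center_in_supp:
  assumes \<nu>: "\<nu> \<in> space cube_prob"
    and pos: "\<And>w. w \<in> words n \<Longrightarrow> 0 < measure \<nu> (dyadic_cube c w)" and w: "\<omega> \<in> words n"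
  shows "center c \<omega> \<in> supp \<nu>"
proof -
  interpret prob_space \<nu> by (rule in_cube_probD[OF \<nu>])
  note sp = in_cube_probD[OF \<nu>]
  have "center c \<omega> \<in> unit_cube"
    using center_in_dyadic_cube dyadic_cube_subset_unit_cube by blast
  moreover have "0 < prob (U \<inter> space \<nu>)" if U: "open U" "center c \<omega> \<in> U" for U
  proof -
    obtain e where e: "0 < e" "ball (center c \<omega>) e \<subseteq> U"
      using U by (auto simp: open_contains_ball)
    obtain k where "real CARD('d) / e < 2 ^ k" using real_arch_pow[of 2] by auto
    then have k: "real CARD('d) * (1 / 2 ^ k) < e" using e by (simp add: field_simps)
    define w where "w = spoke \<omega> (letter_of UNIV) k"
    have "side w \<le> 1 / 2 ^ k"
      unfolding w_def side_def length_spoke by (intro divide_left_mono power_increasing) auto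
    from le_less_trans[OF mult_left_mono[OF this of_nat_0_le_iff] k]
    have "real CARD('d) * side w < e" .
    then have "dyadic_cube c w \<subseteq> ball (center c \<omega>) e"
      by (intro dyadic_cube_subset_ball) (auto simp: w_def center_in_upper_spoke)
    then have sub: "dyadic_cube c w \<subseteq> U \<inter> space \<nu>"
      using e dyadic_cube_subset_unit_cube[of c w] sp(3) by blast
    have "U \<inter> space \<nu> \<in> sets \<nu>"
      unfolding sp(2,3) sets_restrict_space using U(1) by (subst Int_commute) (intro imageI, simp)
    then have "prob (dyadic_cube c w) \<le> prob (U \<inter> space \<nu>)"
      using sub by (rule finite_measure_mono[rotated])
    moreover have "w \<in> words n" unfolding w_def by (rule spoke_words[OF assms(3)]) simp
    ultimately show ?thesis using pos[of w] by simp
  qed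
  ultimately show ?thesis by (simp add: supp_def sp)
qed

text \<open>The small ball is covered by the \<open>n\<close> light spoke cubes, and the large ball
  contains the whole cube; hence the factor \<open>n\<close>.\<close>

lemma measure_ball_center_le:
  assumes \<nu>: "\<nu> \<in> space cube_prob"
    and small: "\<And>i. i \<in> letters n \<Longrightarrow> measure \<nu> (dyadic_cube c (spoke \<omega> i k)) * B \<le> measure \<nu> (dyadic_cube c \<omega>)"
    and B: "0 < B" and R: "real CARD('d) * side \<omega> < R"
  shows "measure \<nu> (ball (center c \<omega>) (side \<omega> / 2 ^ Suc k) \<inter> space \<nu>) * B
      \<le> real n * measure \<nu> (ball (center c \<omega>) R \<inter> space \<nu>)"
proof -
  interpret prob_space \<nu> by (rule in_cube_probD[OF \<nu>])
  note sp = in_cube_probD[OF \<nu>]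
  have cubes: "dyadic_cube c w \<in> sets \<nu>" for w
    unfolding sp(2) by (rule dyadic_cube_sets)
  have balls: "ball (center c \<omega>) r \<inter> space \<nu> \<in> sets \<nu>" for r
    unfolding sp(2,3) sets_restrict_space by (subst Int_commute) (intro imageI, simp)
  have "prob (ball (center c \<omega>) (side \<omega> / 2 ^ Suc k) \<inter> space \<nu>)
      \<le> prob (\<Union>i\<in>letters n. dyadic_cube c (spoke \<omega> i k))"
    using ball_center_subset_spokes[of \<omega> k] cubes
    by (intro finite_measure_mono) auto
  also have "\<dots> \<le> (\<Sum>i\<in>letters n. prob (dyadic_cube c (spoke \<omega> i k)))"
    using cubes by (intro finite_measure_subadditive_finite) auto
  finally have "prob (ball (center c \<omega>) (side \<omega> / 2 ^ Suc k) \<inter> space \<nu>) * B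
      \<le> (\<Sum>i\<in>letters n. prob (dyadic_cube c (spoke \<omega> i k)) * B)"
    using B by (simp add: sum_distrib_right[symmetric])
  also have "\<dots> \<le> (\<Sum>i\<in>letters n. prob (dyadic_cube c \<omega>))"
    using small by (rule sum_mono)
  also have "\<dots> = real n * prob (dyadic_cube c \<omega>)"
    by (simp add: card_letters)
  also have "\<dots> \<le> real n * prob (ball (center c \<omega>) R \<inter> space \<nu>)"
  proof (intro mult_left_mono finite_measure_mono balls)
    show "dyadic_cube c \<omega> \<subseteq> ball (center c \<omega>) R \<inter> space \<nu>"
      using dyadic_cube_subset_ball[OF center_in_dyadic_cube R] dyadic_cube_subset_unit_cube[of c \<omega>]
      by (auto simp: sp(3))
  qed simp
  finally show ?thesis .
qed

text \<open>Balls around the center of a deficient cube, with radii in ratio a constant times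
  \<open>2 ^ m\<close>, have masses in ratio at least \<open>2 ^ (A * m) / n\<close>. Letting
  \<open>m\<close> grow rules out exponents below \<open>A\<close>.\<close>

lemma center_deficient_qA_exponent:
  assumes \<nu>: "\<nu> \<in> space cube_prob"
    and pos: "\<And>w. w \<in> words n \<Longrightarrow> 0 < measure \<nu> (dyadic_cube c w)"
    and def: "center_deficient A \<delta> \<nu>" and \<delta>: "0 < \<delta>" "\<delta> \<le> 1" and \<delta>': "0 < \<delta>'" "\<delta>' \<le> \<delta>"
  shows "ereal (real A) \<le> qA_exponent \<nu> \<delta>'"
  unfolding qA_exponent_def
proof (rule Inf_greatest, safe)
  fix s C :: real
  assume C: "0 < C" and bound: "\<forall>r R. 0 < r \<and> r < R powr (1 + \<delta>') \<and> R powr (1 + \<delta>') < R \<and> R < 1 \<longrightarrow>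
    (SUP x\<in>supp \<nu>. ereal (measure \<nu> (ball x R \<inter> space \<nu>) / measure \<nu> (ball x r \<inter> space \<nu>)))
      \<le> ereal (C * (R / r) powr s)"
  define d where "d = real CARD('d)"
  have d: "1 \<le> d" by (simp add: d_def Suc_le_eq)
  define K where "K = real n * (C * (2 * d) powr s)"
  \<comment> \<open>For \<open>m > k0\<close> the cube is so small that the outer radius is below 1;
    its level is at least \<open>m\<close> since \<delta> is at most 1.\<close>
  obtain k0 where k0: "2 * d < 2 ^ k0" using real_arch_pow[of 2] by auto
  have ev: "\<forall>\<^sub>F m in sequentially. 2 ^ (A * m) \<le> K * (2 powr s) ^ m"
    using def[unfolded center_deficient_def] eventually_gt_at_top[of k0]
  proof eventually_elim
    case (elim m)
    then obtain \<omega> where w: "\<omega> \<in> words n" "length \<omega> = nat \<lfloor>real m / \<delta>\<rfloor>"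
      and small: "\<And>i. i \<in> letters n \<Longrightarrow>
        measure \<nu> (dyadic_cube c (spoke \<omega> i (m - 1))) * 2 ^ (A * m) \<le> measure \<nu> (dyadic_cube c \<omega>)"
      by blast
    have m: "Suc (m - 1) = m" using elim by simp
    let ?l = "length \<omega>"
    have "real m \<le> real m / \<delta>" using \<delta> by (simp add: field_simps mult_left_le_one_le)
    then have lm: "m \<le> ?l" unfolding w(2) by (simp add: le_nat_floor)
    have "real ?l \<le> real m / \<delta>" using \<delta> unfolding w(2) by (simp add: of_nat_floor)
    then have l\<delta>: "real ?l * \<delta> \<le> real m" using \<delta> by (simp add: field_simps)
    let ?x = "center c \<omega>"
    define r where "r = side \<omega> / 2 ^ m"
    \<comment> \<open>The factor 2 makes \<open>R\<close> strictly larger than both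
      \<open>d * side \<omega>\<close>, so that the ball contains the cube, and
      \<open>side \<omega>\<close>, so that the gap condition on the radii is strict.\<close>
    define R where "R = 2 * d * side \<omega>"
    have side: "0 < side \<omega>" by (simp add: side_def)
    have r0: "0 < r" using side by (simp add: r_def)
    have R0: "0 < R" using side d by (simp add: R_def)
    have "(2::real) ^ k0 \<le> 2 ^ ?l" using elim lm by (intro power_increasing) auto
    then have "2 * d < 2 ^ ?l" using k0 by linarith
    then have R1: "R < 1" by (simp add: R_def side_def field_simps)
    have "R powr (1 + \<delta>') < R powr 1"
      using R0 R1 \<delta>' by (intro powr_less_mono') auto
    then have RR: "R powr (1 + \<delta>') < R" using R0 by simp
    have "2 powr (- (real ?l + real m)) = inverse (2 powr (real ?l) * 2 powr (real m))"
      by (subst powr_minus) (simp only: powr_add)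
    then have "r = 2 powr (- (real ?l + real m))"
      by (simp add: r_def side_def powr_realpow divide_inverse)
    \<comment> \<open>The level is at most \<open>m / \<delta>\<close>, so \<open>m\<close> further
      subdivisions shrink the side length at least to its power
      \<open>1 + \<delta>'\<close>.\<close>
    also have "\<dots> \<le> 2 powr (- (real ?l * (1 + \<delta>')))"
    proof (intro powr_mono)
      have "real ?l * \<delta>' \<le> real ?l * \<delta>" using \<delta>' by (intro mult_left_mono) auto
      then show "- (real ?l + real m) \<le> - (real ?l * (1 + \<delta>'))"
        using l\<delta> by (simp add: algebra_simps)
    qed simp
    also have "\<dots> = side \<omega> powr (1 + \<delta>')"
    proof -
      have "side \<omega> = 2 powr (- real ?l)"
        by (simp add: side_def powr_minus powr_realpow divide_inverse)
      then show ?thesis by (simp add: powr_powr)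
    qed
    also have "\<dots> < R powr (1 + \<delta>')"
      using side d \<delta>' by (intro powr_less_mono2) (auto simp: R_def)
    finally have rR: "r < R powr (1 + \<delta>')" .
    let ?a = "measure \<nu> (ball ?x R \<inter> space \<nu>)" and ?b = "measure \<nu> (ball ?x r \<inter> space \<nu>)"
    have x: "?x \<in> supp \<nu>"
      by (rule center_in_supp[OF \<nu> pos w(1)])
    then have b: "0 < ?b" using r0 by (auto simp: supp_def)
    have "?b * 2 ^ (A * m) \<le> real n * ?a"
      using measure_ball_center_le[OF \<nu> small, of R] side d unfolding m
      by (simp add: r_def R_def d_def)
    then have "2 ^ (A * m) \<le> real n * (?a / ?b)" using b by (simp add: field_simps)
    moreover have "ereal (?a / ?b) \<le> ereal (C * (R / r) powr s)"
    proof (rule order_trans)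
      show "ereal (?a / ?b) \<le>
          (SUP x\<in>supp \<nu>. ereal (measure \<nu> (ball x R \<inter> space \<nu>) / measure \<nu> (ball x r \<inter> space \<nu>)))"
        by (rule SUP_upper[OF x])
      show "(SUP x\<in>supp \<nu>. ereal (measure \<nu> (ball x R \<inter> space \<nu>) / measure \<nu> (ball x r \<inter> space \<nu>)))
          \<le> ereal (C * (R / r) powr s)"
        by (rule bound[rule_format]) (intro conjI r0 rR RR R1)
    qed
    then have "real n * (?a / ?b) \<le> real n * (C * (R / r) powr s)"
      by (intro mult_left_mono) auto
    ultimately have "2 ^ (A * m) \<le> real n * (C * (R / r) powr s)" by (rule order_trans)
    also have "R / r = 2 * d * 2 ^ m" using side by (simp add: R_def r_def)
    also have "real n * (C * (2 * d * 2 ^ m) powr s) = K * (2 powr s) ^ m"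
    proof -
      have "(2 ^ m) powr s = (2 powr real m) powr s" by (simp add: powr_realpow)
      also have "\<dots> = (2 powr s) powr real m" by (simp only: powr_powr mult.commute)
      also have "\<dots> = (2 powr s) ^ m" by (rule powr_realpow) simp
      finally show ?thesis using d by (simp add: K_def powr_mult)
    qed
    finally show ?case .
  qed
  show "ereal (real A) \<le> ereal s"
  proof (rule ccontr)
    assume "\<not> ereal (real A) \<le> ereal s"
    \<comment> \<open>For \<open>s < A\<close> the powers of this base would stay bounded by
      \<open>K\<close>, although they tend to infinity.\<close>
    then have y: "1 < 2 powr (real A - s)" by simp
    then obtain m0 where m0: "K < (2 powr (real A - s)) ^ m0" using real_arch_pow by blast
    from ev have "\<forall>\<^sub>F m in sequentially. False"
      using eventually_ge_at_top[of m0]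
    proof eventually_elim
      case (elim m)
      have "(2 powr (real A - s)) ^ m * (2 powr s) ^ m = 2 ^ (A * m)"
      proof -
        have "2 powr (real A - s) * 2 powr s = 2 powr real A" by (simp only: powr_add[symmetric]) simp
        also have "\<dots> = 2 ^ A" by (rule powr_realpow) simp
        finally show ?thesis by (simp only: power_mult_distrib[symmetric] power_mult)
      qed
      then have "(2 powr (real A - s)) ^ m * (2 powr s) ^ m \<le> K * (2 powr s) ^ m"
        using elim(1) by simp
      then have "(2 powr (real A - s)) ^ m \<le> K"
        by (rule mult_right_le_imp_le) simp
      moreover have "(2 powr (real A - s)) ^ m0 \<le> (2 powr (real A - s)) ^ m"
        using y elim(2) by (intro power_increasing) auto
      ultimately show False using m0 by linarith
    qed
    then show False by simp
  qed
qed

end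

section \<open>Products of labels along spokes\<close>

context cascade_labels
begin

definition label_product :: "'a \<Rightarrow> nat list \<Rightarrow> real" where
  "label_product x w = (\<Prod>j<length w. X (take j w) x (w ! j))"

lemma label_product_snoc: "label_product x (w @ [a]) = label_product x w * X w x a"
proof -
  have "(\<Prod>j<length w. X (take j (w @ [a])) x ((w @ [a]) ! j)) = label_product x w"
    unfolding label_product_def by (intro prod.cong) (auto simp: nth_append)
  then show ?thesis by (simp add: label_product_def)
qed

lemma label_product_pos:
  assumes "\<forall>v\<in>words n. \<forall>i\<in>letters n. 0 < X v x i \<and> X v x i \<le> 1" "w \<in> words n"
  shows "0 < label_product x w"
  using assms(2)
proof (induction w rule: rev_induct)
  case (snoc a w)
  then have "w \<in> words n" "a \<in> letters n" by auto
  then show ?case using snoc.IH assms(1) by (auto simp: label_product_snoc)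
qed (simp add: label_product_def)

text \<open>The free first edge contributes a factor at most 1 and each later edge a factor at most
  \<open>e\<close>; hence the exponent is \<open>k\<close>, although the spoke has
  \<open>k + 1\<close> edges.\<close>

lemma label_product_spoke_le:
  assumes bounds: "\<forall>v\<in>words n. \<forall>i\<in>letters n. 0 < X v x i \<and> X v x i \<le> 1"
    and w: "\<omega> \<in> words n" and i: "i \<in> letters n" and x: "x \<in> small_spokes e m \<omega>" and e: "0 \<le> e"
  shows "k \<le> m \<Longrightarrow> label_product x (spoke \<omega> i k) \<le> label_product x \<omega> * e ^ k"
proof (induction k)
  case 0
  have "0 < X \<omega> x i \<and> X \<omega> x i \<le> 1" using bounds w i by blast
  then show ?case
    using label_product_pos[OF bounds w] by (simp add: spoke_def label_product_snoc mult_left_le)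
next
  case (Suc k)
  let ?v = "spoke \<omega> i k"
  have v: "?v \<in> words n" by (rule spoke_words[OF w i])
  have "spoke \<omega> i (Suc k) = ?v @ [letter_of (- c i)]"
    by (simp add: spoke_def replicate_append_same)
  then have "label_product x (spoke \<omega> i (Suc k)) = label_product x ?v * X ?v x (letter_of (- c i))"
    by (simp add: label_product_snoc)
  also have "\<dots> \<le> (label_product x \<omega> * e ^ k) * e"
  proof (rule mult_mono)
    show "label_product x ?v \<le> label_product x \<omega> * e ^ k" using Suc by simp
    show "X ?v x (letter_of (- c i)) \<le> e" using x i Suc.prems by (simp add: small_spokes_def)
    show "0 \<le> label_product x \<omega> * e ^ k"
      using label_product_pos[OF bounds w] e by simp
    show "0 \<le> X ?v x (letter_of (- c i))"
      using bounds v letter_of(1) less_imp_le by blast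
  qed
  finally show ?case by (simp add: mult_ac)
qed

end

text \<open>Natural thresholds suffice, so that only countably many null sets have to be
  discarded.\<close>

lemma tendsto_PInfty_cofinal:
  fixes f :: "'a \<Rightarrow> ereal"
  assumes "\<And>A::nat. \<forall>\<^sub>F x in F. ereal (real A) \<le> f x"
  shows "(f \<longlongrightarrow> \<infinity>) F"
proof (unfold tendsto_PInfty, rule allI)
  fix r :: real
  obtain A :: nat where "r < real A" using reals_Archimedean2 by blast
  then have "ereal r < ereal (real A)" by simp
  then show "\<forall>\<^sub>F x in F. ereal r < f x"
    using assms[of A] by (elim eventually_mono) (rule less_le_trans)
qed

section \<open>Transfer to the law of the random measure and passage to the limit\<close>

theorem theorem4p3:
  fixes n :: nat
    and c :: "nat \<Rightarrow> ('d::finite) set"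
    and M :: "'a measure"
    and X :: "nat list \<Rightarrow> 'a \<Rightarrow> nat \<Rightarrow> real"
    and \<mu> :: "'a \<Rightarrow> (real ^ 'd) measure"
    and P :: "(real ^ 'd) measure measure"
  assumes n: "n = 2 ^ CARD('d)"
    and c: "bij_betw c (letters n) UNIV"
    and cascade: "random_cascade n c M X \<mu>"
    and P: "P = distr M cube_prob \<mu>"
  shows "(\<forall>\<delta> :: nat \<Rightarrow> real. (\<forall>k. 0 < \<delta> k) \<and> decseq \<delta> \<and> \<delta> \<longlonglongrightarrow> 0 \<longrightarrow>
            {\<nu> \<in> space P. \<exists>L::real.
               (\<lambda>k. limsup (\<lambda>m. elog2 (H_max n c m (\<delta> k) \<nu>) / ereal (real m))) \<longlonglongrightarrow> ereal L}
              \<in> null_sets P)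
         \<and> (AE \<nu> in P. dim_qA \<nu> = \<infinity>)"
proof -
  interpret prob_space M using cascade by (simp add: random_cascade_def)
  interpret cascade_labels n c M X
    using cascade n c by unfold_locales (auto simp: random_cascade_def)
  have \<mu>: "\<mu> \<in> M \<rightarrow>\<^sub>M cube_prob" using cascade by (simp add: random_cascade_def)
  have mass: "AE x in M. \<forall>w\<in>words n. measure (\<mu> x) (dyadic_cube c w) = label_product x w"
    using cascade by (simp add: random_cascade_def label_product_def)
  have space_P: "space P = space cube_prob" by (simp add: P)
  have AE_P: "AE \<nu> in P. Q \<nu>" if "{\<nu> \<in> space cube_prob. Q \<nu>} \<in> sets cube_prob" "AE x in M. Q (\<mu> x)" for Q
    unfolding P using that \<mu> by (subst AE_distr_iff)

  have "AE x in M. \<forall>w\<in>words n. 0 < measure (\<mu> x) (dyadic_cube c w)"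
    using mass AE_label_bounds by eventually_elim (auto intro: label_product_pos)
  moreover have "{\<nu> \<in> space cube_prob. \<forall>w\<in>words n. 0 < measure \<nu> (dyadic_cube c w)} \<in> sets cube_prob"
  proof -
    note [measurable] = measurable_mass
    show ?thesis by measurable
  qed
  ultimately have pos: "AE \<nu> in P. \<forall>w\<in>words n. 0 < measure \<nu> (dyadic_cube c w)"
    by (rule AE_P[rotated])

  have "\<exists>N>0. \<forall>\<delta>. 0 < \<delta> \<and> \<delta> \<le> 1 / real N \<longrightarrow> (AE \<nu> in P. center_deficient A \<delta> \<nu>)" for A
  proof -
    \<comment> \<open>Only \<open>m - 1\<close> edges on the way to a central child are known to be
      small. Since \<open>2 * (m - 1) \<ge> m\<close> for \<open>m \<ge> 2\<close>, the exponent
      \<open>2 * A\<close> makes up for the lost edge; adding 1 keeps \<open>e < 1\<close> for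
      \<open>A = 0\<close>.\<close>
    define e :: real where "e = (1 / 2) ^ (2 * A + 1)"
    have e: "0 < e" "e < 1" using power_le_one[of "1 / 2 :: real" "2 * A"] by (auto simp: e_def)
    obtain N :: nat where N: "0 < N" and ev: "\<And>\<delta>. 0 < \<delta> \<Longrightarrow> \<delta> \<le> 1 / real N \<Longrightarrow>
       AE x in M. \<forall>\<^sub>F m in sequentially. \<exists>\<omega>\<in>words n. length \<omega> = nat \<lfloor>real m / \<delta>\<rfloor> \<and> x \<in> small_spokes e m \<omega>"
      using AE_eventually_small_spokes[OF e] by blast
    have "AE \<nu> in P. center_deficient A \<delta> \<nu>" if \<delta>: "0 < \<delta>" "\<delta> \<le> 1 / real N" for \<delta>
    proof (rule AE_P[OF sets_center_deficient])
      show "AE x in M. center_deficient A \<delta> (\<mu> x)"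
        using ev[OF \<delta>] mass AE_label_bounds
      proof eventually_elim
        case (elim x)
        note mass_x = elim(2) and bounds = elim(3)
        from elim(1) eventually_ge_at_top[of 2] show ?case
          unfolding center_deficient_def
        proof eventually_elim
          case (elim m)
          then obtain \<omega> where w: "\<omega> \<in> words n" "length \<omega> = nat \<lfloor>real m / \<delta>\<rfloor>" and x: "x \<in> small_spokes e m \<omega>"
            by blast
          have "e ^ (m - 1) = (1 / 2) ^ ((2 * A + 1) * (m - 1))"
            by (simp only: e_def power_mult)
          also have "\<dots> \<le> (1 / 2) ^ (A * m)"
          proof (rule power_decreasing)
            have "A * m \<le> A * (2 * (m - 1))" using elim(2) by (intro mult_left_mono) auto
            then show "A * m \<le> (2 * A + 1) * (m - 1)" by (simp add: algebra_simps)
          qed auto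
          finally have em: "e ^ (m - 1) * 2 ^ (A * m) \<le> 1" by (simp add: power_one_over field_simps)
          have "measure (\<mu> x) (dyadic_cube c (spoke \<omega> i (m - 1))) * 2 ^ (A * m)
              \<le> measure (\<mu> x) (dyadic_cube c \<omega>)" if i: "i \<in> letters n" for i
          proof -
            have "label_product x (spoke \<omega> i (m - 1)) * 2 ^ (A * m)
                \<le> label_product x \<omega> * e ^ (m - 1) * 2 ^ (A * m)"
              using e by (intro mult_right_mono label_product_spoke_le[OF bounds w(1) i x]) auto
            also have "\<dots> = label_product x \<omega> * (e ^ (m - 1) * 2 ^ (A * m))" by simp
            also have "\<dots> \<le> label_product x \<omega>"
              using em label_product_pos[OF bounds w(1)] by (intro mult_left_le) auto
            finally show ?thesis
              using mass_x w(1) spoke_words[OF w(1) i] by simp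
          qed
          then show ?case using w by blast
        qed
      qed
    qed
    then show ?thesis using N by blast
  qed
  then obtain N where N: "\<And>A. 0 < N A"
    and def: "\<And>A \<delta>. 0 < \<delta> \<Longrightarrow> \<delta> \<le> 1 / real (N A) \<Longrightarrow> AE \<nu> in P. center_deficient A \<delta> \<nu>"
    by metis

  have "{\<nu> \<in> space P. \<exists>L::real.
               (\<lambda>k. limsup (\<lambda>m. elog2 (H_max n c m (\<delta> k) \<nu>) / ereal (real m))) \<longlonglongrightarrow> ereal L}
              \<in> null_sets P" (is "{\<nu> \<in> space P. ?lim \<nu>} \<in> _")
    if \<delta>: "\<And>k. 0 < \<delta> k" "\<delta> \<longlonglongrightarrow> 0" for \<delta> :: "nat \<Rightarrow> real"
  proof -
    define f where "f k \<nu> = limsup (\<lambda>m. elog2 (H_max n c m (\<delta> k) \<nu>) / ereal (real m))" for k \<nu>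
    have f: "f k \<in> borel_measurable cube_prob" for k
      unfolding f_def
      by (intro borel_measurable_limsup borel_measurable_ereal_divide borel_measurable_const
          measurable_compose[OF measurable_H_max measurable_elog2])
    \<comment> \<open>Expressing convergence by the lower and upper limits removes the quantifier
      over real \<open>L\<close> and makes the event measurable.\<close>
    have lim_iff: "?lim \<nu> \<longleftrightarrow> liminf (\<lambda>k. f k \<nu>) = limsup (\<lambda>k. f k \<nu>) \<and> \<bar>limsup (\<lambda>k. f k \<nu>)\<bar> \<noteq> \<infinity>" for \<nu>
      unfolding f_def[symmetric] by (auto simp: tendsto_iff_Liminf_eq_Limsup)
    have "{\<nu> \<in> space P. ?lim \<nu>} \<in> sets P"
      unfolding lim_iff space_P using f by (simp add: P)
    moreover have "AE \<nu> in P. \<not> ?lim \<nu>"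
    proof -
      \<comment> \<open>With the sequence fixed, only countably many pairs of \<open>A\<close> and
        \<open>k\<close> occur, so a single null set serves for all of them.\<close>
      have "AE \<nu> in P. \<forall>A k. \<delta> k \<le> 1 / real (N A) \<longrightarrow> center_deficient A (\<delta> k) \<nu>"
        unfolding AE_all_countable by (intro allI AE_impI def \<delta>(1))
      then show ?thesis
      proof eventually_elim
        case (elim \<nu>)
        have infty: "(\<lambda>k. f k \<nu>) \<longlonglongrightarrow> \<infinity>"
        proof (rule tendsto_PInfty_cofinal)
          fix A
          have "\<forall>\<^sub>F k in sequentially. \<delta> k < 1 / real (N A)"
            using \<delta>(2) N[of A] by (intro order_tendstoD(2)) auto
          then show "\<forall>\<^sub>F k in sequentially. ereal (real A) \<le> f k \<nu>"
            by eventually_elim (use elim in \<open>auto simp: f_def intro: center_deficient_H_max\<close>)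
        qed
        show ?case
        proof
          assume "?lim \<nu>"
          then obtain L :: real where "(\<lambda>k. f k \<nu>) \<longlonglongrightarrow> ereal L"
            unfolding f_def by blast
          from LIMSEQ_unique[OF this infty] show False by simp
        qed
      qed
    qed
    ultimately show ?thesis by (simp add: AE_iff_null)
  qed
  moreover have "AE \<nu> in P. dim_qA \<nu> = \<infinity>"
  proof -
    \<comment> \<open>One scale per \<open>A\<close> suffices for the continuous limit: deficiency
      at \<open>1 / N A\<close> bounds the exponent at every smaller \<delta>', so uncountably many
      exceptional sets never arise.\<close>
    have "AE \<nu> in P. \<forall>A. center_deficient A (1 / real (N A)) \<nu>"
      unfolding AE_all_countable using def N by auto
    then show ?thesis
      using pos AE_space
    proof eventually_elim
      case (elim \<nu>)
      have \<nu>: "\<nu> \<in> space cube_prob" using elim(3) by (simp add: space_P)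
      have "(qA_exponent \<nu> \<longlongrightarrow> \<infinity>) (at_right 0)"
      proof (rule tendsto_PInfty_cofinal)
        fix A
        have "\<forall>\<^sub>F \<delta>' in at_right 0. \<delta>' \<in> {0<..<1 / real (N A)}"
          using N[of A] by (intro eventually_at_right_real) auto
        then show "\<forall>\<^sub>F \<delta>' in at_right 0. ereal (real A) \<le> qA_exponent \<nu> \<delta>'"
        proof eventually_elim
          case (elim \<delta>')
          show ?case
            using \<nu> \<open>\<forall>w\<in>words n. 0 < measure \<nu> (dyadic_cube c w)\<close>
              \<open>\<forall>A. center_deficient A (1 / real (N A)) \<nu>\<close> N[of A] elim
            by (intro center_deficient_qA_exponent[where \<delta> = "1 / real (N A)"]) auto
        qed
      qed
      then show ?case
        unfolding dim_qA_def by (intro tendsto_Lim) auto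
    qed
  qed
  ultimately show ?thesis by blast
qed

end
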